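(* Let $D$ be a link diagram and let $q=e^{i\theta}$ with $\theta\in\mathbb{R}$. Let $\mathcal{H}(D)$ be the complex Hilbert space with orthonormal basis $\{|s\rangle\}$ in one-to-one correspondence with the enhanced states $s$ of $D$. Let $U:\mathcal{H}(D)\to\mathcal{H}(D)$ be the linear map given by $$U|s\rangle=(-1)^{n_B(s)}q^{j(s)}|s\rangle,$$ and let $|\psi\rangle=\sum_s|s\rangle$. Then $U$ is unitary and $$\langle D\rangle=\langle\psi|U|\psi\rangle,$$ where $\langle D\rangle$ is the bracket polynomial of $D$ evaluated at $q$. Thus the bracket polynomial is expressed as a quantum amplitude whenever its variable is on the unit circle in the complex plane.
   Context: Bracket polynomial: each crossing of $D$ has an $A$-smoothing and a $B$-smoothing (the $A$-smoothing joins the two local regions swept out by turning the overcrossing strand counterclockwise; the $B$-smoothing joins the other two). The bracket $\langle D\rangle$, a Laurent polynomial in $q$, is defined by the expansion, at each crossing, $\langle D\rangle=\langle D_A\rangle-q\langle D_B\rangle$, where $D_A,D_B$ are obtained from $D$ by $A$-, respectively $B$-smoothing that crossing, and each loop has value $q+q^{-1}$ (a disjoint union of $m$ crossingless loops has bracket $(q+q^{-1})^m$). An enhanced state $s$ of $D$ is a choice of smoothing at every crossing together with a label $1$ or $-1$ on each resulting loop. $n_B(s)$ is the number of $B$-smoothings in $s$; $\lambda(s)$ is the number of loops labeled $1$ minus the number of loops labeled $-1$; $j(s)=n_B(s)+\lambda(s)$. The vector $|\psi\rangle$ is not normalized. *)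

theory Defs
  imports
    Complex_Main
    "HOL-Library.FuncSet"
    "HOL-Library.Function_Algebras"
    "HOL-Library.Poly_Mapping"
begin

section \<open>Link diagrams\<close>

text \<open>
  Unoriented link diagrams are given by planar diagram codes. The edges of the diagram are labelled
  by natural numbers. A crossing \<open>(a, b, c, d)\<close> lists its four incident edges counterclockwise,
  starting at one of the two ends of the undercrossing strand, so that \<open>a, c\<close> belong to the
  undercrossing and \<open>b, d\<close> to the overcrossing strand; \<open>(a, b, c, d)\<close> and \<open>(c, d, a, b)\<close> denote the
  same crossing. A join \<open>(a, b)\<close> is a bivalent vertex, i.e. a point at which the edge \<open>a\<close> is
  continued by the edge \<open>b\<close>. Joins are what smoothings leave behind, and they also
  provide components without crossings: the join \<open>(a, a)\<close> is a crossingless loop.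
\<close>

type_synonym crossing = "nat \<times> nat \<times> nat \<times> nat"

datatype diagram = Diagram (crossings: "crossing list") (joins: "(nat \<times> nat) list")

definition vertices :: "diagram \<Rightarrow> nat list list" where
  "vertices D = map (\<lambda>(a, b, c, d). [a, b, c, d]) (crossings D) @ map (\<lambda>(a, b). [a, b]) (joins D)"

text \<open>A dart \<open>(v, i)\<close> is the \<open>i\<close>-th edge end, counted counterclockwise, at the vertex \<open>v\<close>.\<close>

definition darts :: "diagram \<Rightarrow> (nat \<times> nat) set" where
  "darts D = {(v, i). v < length (vertices D) \<and> i < length (vertices D ! v)}"

definition dart_edge :: "diagram \<Rightarrow> nat \<times> nat \<Rightarrow> nat" where
  "dart_edge D = (\<lambda>(v, i). vertices D ! v ! i)"

definition next_dart :: "diagram \<Rightarrow> nat \<times> nat \<Rightarrow> nat \<times> nat" where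
  "next_dart D = (\<lambda>(v, i). (v, (i + 1) mod length (vertices D ! v)))"

text \<open>Walking along the boundary of a face: leave along an edge, then turn at its other end.\<close>

definition face_step :: "diagram \<Rightarrow> ((nat \<times> nat) \<times> (nat \<times> nat)) set" where
  "face_step D = {(x, next_dart D y) | x y.
     x \<in> darts D \<and> y \<in> darts D \<and> x \<noteq> y \<and> dart_edge D x = dart_edge D y}"

definition faces :: "diagram \<Rightarrow> (nat \<times> nat) set set" where
  "faces D = darts D // (face_step D)\<^sup>*"

definition components :: "diagram \<Rightarrow> (nat \<times> nat) set set" where
  "components D = darts D // {(x, y). x \<in> darts D \<and> y \<in> darts D \<and>
     (fst x = fst y \<or> dart_edge D x = dart_edge D y)}\<^sup>*"

text \<open>
  Every edge has exactly two ends, and every connected component of the underlying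
  graph has Euler characteristic 2. Each component has Euler characteristic at most 2, so that it
  suffices to require \<open>V - E + F = 2 C\<close> for the whole diagram.
\<close>

definition link_diagram :: "diagram \<Rightarrow> bool" where
  "link_diagram D \<longleftrightarrow>
     (\<forall>x \<in> darts D. card {y \<in> darts D. dart_edge D y = dart_edge D x} = 2) \<and>
     length (vertices D) + card (faces D) = card (dart_edge D ` darts D) + 2 * card (components D)"

section \<open>Smoothings and the bracket polynomial\<close>

datatype smoothing = A_smoothing | B_smoothing

text \<open>
  Turning the overcrossing strand \<open>b - d\<close> of \<open>(a, b, c, d)\<close> counterclockwise, its end \<open>b\<close> moves
  towards \<open>c\<close> and its end \<open>d\<close> towards \<open>a\<close>. It sweeps out the regions between \<open>b\<close> and \<open>c\<close> and between
  \<open>d\<close> and \<open>a\<close>. When these two regions are joined, the remaining strands are \<open>a - b\<close> and \<open>c - d\<close>.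
\<close>

fun smooth_crossing :: "smoothing \<Rightarrow> crossing \<Rightarrow> (nat \<times> nat) list" where
  "smooth_crossing A_smoothing (a, b, c, d) = [(a, b), (c, d)]"
| "smooth_crossing B_smoothing (a, b, c, d) = [(a, d), (b, c)]"

definition smooth_at :: "smoothing \<Rightarrow> nat \<Rightarrow> diagram \<Rightarrow> diagram" where
  "smooth_at t i D =
     Diagram (take i (crossings D) @ drop (Suc i) (crossings D))
             (smooth_crossing t (crossings D ! i) @ joins D)"

text \<open>The loops of a crossingless diagram, each given as the set of the edges it consists of.\<close>

definition loops :: "(nat \<times> nat) list \<Rightarrow> nat set set" where
  "loops js = (fst ` set js \<union> snd ` set js) // (set js \<union> (set js)\<inverse>)\<^sup>*"

text \<open>
  The group ring of the integers over \<open>int\<close> is the ring of Laurent polynomials with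
  integer coefficients; the monomial with exponent \<open>k\<close> is \<open>Poly_Mapping.single k 1\<close>.
\<close>

type_synonym laurent = "int \<Rightarrow>\<^sub>0 int"

abbreviation laurent_var :: laurent where
  "laurent_var \<equiv> Poly_Mapping.single 1 1"

abbreviation loop_value :: laurent where
  "loop_value \<equiv> Poly_Mapping.single 1 1 + Poly_Mapping.single (- 1) 1"

definition laurent_eval :: "laurent \<Rightarrow> complex \<Rightarrow> complex" where
  "laurent_eval p z = (\<Sum>k \<in> Poly_Mapping.keys p. of_int (Poly_Mapping.lookup p k) * z powi k)"

text \<open>
  The recursion expands at the first crossing in the list; by \<open>bracket_smooth_at\<close> below, the same
  expansion holds at every crossing.
\<close>

function bracket :: "diagram \<Rightarrow> laurent" where
  "bracket (Diagram [] js) = loop_value ^ card (loops js)"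
| "bracket (Diagram (x # xs) js) =
     bracket (Diagram xs (smooth_crossing A_smoothing x @ js))
     - laurent_var * bracket (Diagram xs (smooth_crossing B_smoothing x @ js))"
  by pat_completeness auto
termination
  by (relation "measure (\<lambda>D. length (crossings D))") auto

lemma bracket_cong_joins:
  "set js = set js' \<Longrightarrow> bracket (Diagram xs js) = bracket (Diagram xs js')"
proof (induction xs arbitrary: js js')
  case Nil
  then show ?case by (simp add: loops_def)
next
  case (Cons x xs)
  have "bracket (Diagram xs (smooth_crossing t x @ js))
      = bracket (Diagram xs (smooth_crossing t x @ js'))" for t
    by (rule Cons.IH) (simp add: Cons.prems)
  then show ?case by simp
qed

lemma bracket_expand_middle:
  "bracket (Diagram (xs @ x # ys) js) =
     bracket (Diagram (xs @ ys) (smooth_crossing A_smoothing x @ js))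
     - laurent_var * bracket (Diagram (xs @ ys) (smooth_crossing B_smoothing x @ js))"
proof (induction xs arbitrary: js)
  case Nil
  show ?case by simp
next
  case (Cons z xs)
  have swap: "bracket (Diagram (xs @ ys) (smooth_crossing t x @ smooth_crossing u z @ js))
      = bracket (Diagram (xs @ ys) (smooth_crossing u z @ smooth_crossing t x @ js))" for t u
    by (rule bracket_cong_joins) auto
  show ?case
    by (simp add: Cons.IH swap algebra_simps)
qed

lemma bracket_smooth_at:
  assumes "i < length (crossings D)"
  shows "bracket D =
    bracket (smooth_at A_smoothing i D) - laurent_var * bracket (smooth_at B_smoothing i D)"
proof -
  have "D = Diagram (take i (crossings D) @ crossings D ! i # drop (Suc i) (crossings D)) (joins D)"
    using assms by (simp add: id_take_nth_drop [symmetric])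
  then have "bracket D =
    bracket (Diagram (take i (crossings D) @ crossings D ! i # drop (Suc i) (crossings D)) (joins D))"
    by (rule arg_cong)
  then show ?thesis
    by (simp only: bracket_expand_middle smooth_at_def)
qed

section \<open>Enhanced states\<close>

definition resolution :: "diagram \<Rightarrow> smoothing list \<Rightarrow> (nat \<times> nat) list" where
  "resolution D ts = concat (map2 smooth_crossing ts (crossings D)) @ joins D"

type_synonym enhanced_state = "smoothing list \<times> (nat set \<Rightarrow> int)"

definition enhanced_states :: "diagram \<Rightarrow> enhanced_state set" where
  "enhanced_states D =
     {(ts, l). length ts = length (crossings D) \<and> l \<in> loops (resolution D ts) \<rightarrow>\<^sub>E {1, - 1}}"

definition n_B :: "enhanced_state \<Rightarrow> nat" where
  "n_B s = length (filter (\<lambda>t. t = B_smoothing) (fst s))"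

definition state_lambda :: "diagram \<Rightarrow> enhanced_state \<Rightarrow> int" where
  "state_lambda D s =
     int (card {c \<in> loops (resolution D (fst s)). snd s c = 1})
     - int (card {c \<in> loops (resolution D (fst s)). snd s c = - 1})"

definition state_j :: "diagram \<Rightarrow> enhanced_state \<Rightarrow> int" where
  "state_j D s = int (n_B s) + state_lambda D s"

section \<open>Complex Hilbert spaces\<close>

text \<open>
  The space is a subspace \<open>V\<close> of an ambient complex vector space. The inner product is linear in
  its second argument.
\<close>

locale complex_hilbert_space = vector_space scale
  for scale :: "complex \<Rightarrow> 'h::ab_group_add \<Rightarrow> 'h" +
  fixes V :: "'h set" and inner :: "'h \<Rightarrow> 'h \<Rightarrow> complex"
  assumes subspace_V: "subspace V"
    and inner_commute: "x \<in> V \<Longrightarrow> y \<in> V \<Longrightarrow> inner y x = cnj (inner x y)"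
    and inner_add_right: "x \<in> V \<Longrightarrow> y \<in> V \<Longrightarrow> z \<in> V \<Longrightarrow> inner x (y + z) = inner x y + inner x z"
    and inner_scale_right: "x \<in> V \<Longrightarrow> y \<in> V \<Longrightarrow> inner x (scale c y) = c * inner x y"
    and inner_pos: "x \<in> V \<Longrightarrow> x \<noteq> 0 \<Longrightarrow> 0 < Re (inner x x)"
    and complete: "range X \<subseteq> V \<Longrightarrow>
      (\<And>e. e > 0 \<Longrightarrow> \<exists>N. \<forall>m\<ge>N. \<forall>n\<ge>N. sqrt (Re (inner (X m - X n) (X m - X n))) < e) \<Longrightarrow>
      \<exists>x \<in> V. (\<lambda>n. sqrt (Re (inner (X n - x) (X n - x)))) \<longlonglongrightarrow> 0"

text \<open>For finite \<open>S\<close>, where the algebraic span is already closed.\<close>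

definition orthonormal_basis ::
  "(complex \<Rightarrow> 'h::ab_group_add \<Rightarrow> 'h) \<Rightarrow> 'h set \<Rightarrow> ('h \<Rightarrow> 'h \<Rightarrow> complex) \<Rightarrow> 's set \<Rightarrow> ('s \<Rightarrow> 'h) \<Rightarrow> bool"
where
  "orthonormal_basis scale V inner S ket \<longleftrightarrow>
     finite S \<and> ket ` S \<subseteq> V \<and>
     (\<forall>s \<in> S. \<forall>t \<in> S. inner (ket s) (ket t) = (if s = t then 1 else 0)) \<and>
     module.span scale (ket ` S) = V"

definition linear_map_on ::
  "(complex \<Rightarrow> 'h::ab_group_add \<Rightarrow> 'h) \<Rightarrow> 'h set \<Rightarrow> ('h \<Rightarrow> 'h) \<Rightarrow> bool"
where
  "linear_map_on scale V U \<longleftrightarrow>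
     U ` V \<subseteq> V \<and>
     (\<forall>x \<in> V. \<forall>y \<in> V. U (x + y) = U x + U y) \<and>
     (\<forall>c. \<forall>x \<in> V. U (scale c x) = scale c (U x))"

definition unitary_map_on ::
  "(complex \<Rightarrow> 'h::ab_group_add \<Rightarrow> 'h) \<Rightarrow> 'h set \<Rightarrow> ('h \<Rightarrow> 'h \<Rightarrow> complex) \<Rightarrow> ('h \<Rightarrow> 'h) \<Rightarrow> bool"
where
  "unitary_map_on scale V inner U \<longleftrightarrow>
     linear_map_on scale V U \<and> U ` V = V \<and>
     (\<forall>x \<in> V. \<forall>y \<in> V. inner (U x) (U y) = inner x y)"

section \<open>Existence of the state space\<close>

lemma finite_loops: "finite (loops js)"
  by (simp add: loops_def quotient_def)

lemma finite_enhanced_states: "finite (enhanced_states D)"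
proof -
  have fin: "finite (UNIV :: smoothing set)"
  proof (rule finite_subset)
    show "UNIV \<subseteq> {A_smoothing, B_smoothing}"
      using smoothing.exhaust by blast
  qed simp
  have "finite {ts :: smoothing list. length ts = length (crossings D)}"
    using finite_lists_length_eq [OF fin, of "length (crossings D)"] by simp
  moreover have "finite (loops (resolution D ts) \<rightarrow>\<^sub>E {1, - 1 :: int})" for ts
    by (rule finite_PiE) (auto simp: finite_loops)
  moreover have "enhanced_states D = Sigma {ts. length ts = length (crossings D)}
      (\<lambda>ts. loops (resolution D ts) \<rightarrow>\<^sub>E {1, - 1})"
    by (auto simp: enhanced_states_def)
  ultimately show ?thesis by (simp add: finite_SigmaI)
qed

definition fun_scale :: "complex \<Rightarrow> ('s \<Rightarrow> complex) \<Rightarrow> 's \<Rightarrow> complex" where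
  "fun_scale c f = (\<lambda>s. c * f s)"

definition fun_space :: "'s set \<Rightarrow> ('s \<Rightarrow> complex) set" where
  "fun_space S = {f. \<forall>s. s \<notin> S \<longrightarrow> f s = 0}"

definition fun_inner :: "'s set \<Rightarrow> ('s \<Rightarrow> complex) \<Rightarrow> ('s \<Rightarrow> complex) \<Rightarrow> complex" where
  "fun_inner S f g = (\<Sum>s \<in> S. cnj (f s) * g s)"

definition fun_ket :: "'s \<Rightarrow> 's \<Rightarrow> complex" where
  "fun_ket s = (\<lambda>t. if t = s then 1 else 0)"

interpretation fun_vs: vector_space fun_scale
  by unfold_locales (auto simp: fun_scale_def fun_eq_iff algebra_simps)

lemma Re_fun_inner_self: "Re (fun_inner S f f) = (\<Sum>s \<in> S. (cmod (f s))\<^sup>2)"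
  unfolding fun_inner_def cmod_power2 by (simp add: power2_eq_square)

lemma fun_space_hilbert:
  fixes S :: "'s set"
  assumes fin: "finite S"
  shows "complex_hilbert_space fun_scale (fun_space S) (fun_inner S)"
proof unfold_locales
  show "fun_vs.subspace (fun_space S)"
    by (auto simp: fun_vs.subspace_def fun_space_def fun_scale_def)
next
  fix x y z :: "'s \<Rightarrow> complex" and c
  show "fun_inner S y x = cnj (fun_inner S x y)"
    by (simp add: fun_inner_def mult.commute)
  show "fun_inner S x (y + z) = fun_inner S x y + fun_inner S x z"
    by (simp add: fun_inner_def algebra_simps sum.distrib)
  show "fun_inner S x (fun_scale c y) = c * fun_inner S x y"
    by (simp add: fun_inner_def fun_scale_def sum_distrib_left algebra_simps)
next
  fix x :: "'s \<Rightarrow> complex"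
  assume "x \<in> fun_space S" and "x \<noteq> 0"
  then obtain s where "s \<in> S" and "x s \<noteq> 0"
    by (auto simp: fun_space_def fun_eq_iff)
  then have "0 < (\<Sum>s \<in> S. (cmod (x s))\<^sup>2)"
    by (intro sum_pos2 [OF fin]) auto
  then show "0 < Re (fun_inner S x x)"
    by (simp add: Re_fun_inner_self)
next
  fix X :: "nat \<Rightarrow> 's \<Rightarrow> complex"
  assume X: "range X \<subseteq> fun_space S"
    and cauchy: "\<And>e. e > 0 \<Longrightarrow>
      \<exists>N. \<forall>m\<ge>N. \<forall>n\<ge>N. sqrt (Re (fun_inner S (X m - X n) (X m - X n))) < e"
  have le: "cmod (f s) \<le> sqrt (Re (fun_inner S f f))" if "s \<in> S" for f s
    unfolding Re_fun_inner_self
    by (rule real_le_rsqrt) (rule member_le_sum [OF that _ fin], simp)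
  have "convergent (\<lambda>n. X n s)" if s: "s \<in> S" for s
  proof (rule Cauchy_convergent, rule CauchyI)
    fix e :: real
    assume "e > 0"
    from cauchy [OF this] obtain N
      where N: "\<forall>m\<ge>N. \<forall>n\<ge>N. sqrt (Re (fun_inner S (X m - X n) (X m - X n))) < e" ..
    show "\<exists>M. \<forall>m\<ge>M. \<forall>n\<ge>M. norm (X m s - X n s) < e"
    proof (intro exI allI impI)
      fix m n
      assume "N \<le> m" "N \<le> n"
      with N have "sqrt (Re (fun_inner S (X m - X n) (X m - X n))) < e" by blast
      with le [OF s, of "X m - X n"] show "norm (X m s - X n s) < e" by simp
    qed
  qed
  then have lim: "(\<lambda>n. X n s) \<longlonglongrightarrow> lim (\<lambda>n. X n s)" if "s \<in> S" for s
    using that by (simp add: convergent_LIMSEQ_iff)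
  define x where "x = (\<lambda>s. if s \<in> S then lim (\<lambda>n. X n s) else 0)"
  have "(\<lambda>n. sqrt (\<Sum>s \<in> S. (cmod (X n s - x s))\<^sup>2)) \<longlonglongrightarrow> sqrt (\<Sum>s \<in> S. (cmod (x s - x s))\<^sup>2)"
    using lim by (intro tendsto_intros) (simp add: x_def)
  then have "(\<lambda>n. sqrt (Re (fun_inner S (X n - x) (X n - x)))) \<longlonglongrightarrow> 0"
    by (simp add: Re_fun_inner_self)
  moreover have "x \<in> fun_space S"
    by (simp add: x_def fun_space_def)
  ultimately show "\<exists>x \<in> fun_space S. (\<lambda>n. sqrt (Re (fun_inner S (X n - x) (X n - x)))) \<longlonglongrightarrow> 0"
    by blast
qed

lemma fun_ket_basis:
  fixes S :: "'s set"
  assumes fin: "finite S"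
  shows "orthonormal_basis fun_scale (fun_space S) (fun_inner S) S fun_ket"
proof -
  have sub: "fun_ket ` S \<subseteq> fun_space S"
    by (auto simp: fun_ket_def fun_space_def)
  have "fun_inner S (fun_ket s) (fun_ket t) = (if s = t then 1 else 0)" if "s \<in> S" for s t
  proof -
    have "fun_inner S (fun_ket s) (fun_ket t) = (\<Sum>u \<in> S. if u = s then if s = t then 1 else 0 else 0)"
      unfolding fun_inner_def by (rule sum.cong) (auto simp: fun_ket_def)
    with that fin show ?thesis by simp
  qed
  moreover have "fun_vs.span (fun_ket ` S) = fun_space S"
  proof
    interpret complex_hilbert_space fun_scale "fun_space S" "fun_inner S"
      by (rule fun_space_hilbert [OF fin])
    show "fun_vs.span (fun_ket ` S) \<subseteq> fun_space S"
      by (rule fun_vs.span_minimal [OF sub subspace_V])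
    show "fun_space S \<subseteq> fun_vs.span (fun_ket ` S)"
    proof
      fix f
      assume f: "f \<in> fun_space S"
      have sum_apply: "(\<Sum>s \<in> T. g s) t = (\<Sum>s \<in> T. g s t)" for g :: "'s \<Rightarrow> 's \<Rightarrow> complex" and T t
        by (induction T rule: infinite_finite_induct) auto
      have "f t = (\<Sum>s \<in> S. fun_scale (f s) (fun_ket s)) t" for t
      proof -
        have "(\<Sum>s \<in> S. fun_scale (f s) (fun_ket s)) t = (\<Sum>s \<in> S. if t = s then f s else 0)"
          unfolding sum_apply by (rule sum.cong) (auto simp: fun_scale_def fun_ket_def)
        also have "\<dots> = f t"
          using f fin by (auto simp: fun_space_def)
        finally show ?thesis ..
      qed
      then have "f = (\<Sum>s \<in> S. fun_scale (f s) (fun_ket s))"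
        by (rule ext)
      also have "\<dots> \<in> fun_vs.span (fun_ket ` S)"
        by (intro fun_vs.span_sum fun_vs.span_scale fun_vs.span_base imageI)
      finally show "f \<in> fun_vs.span (fun_ket ` S)" .
    qed
  qed
  ultimately show ?thesis
    using fin sub by (auto simp: orthonormal_basis_def)
qed

text \<open>So every diagram has a state space as assumed for \<open>\<H>(D)\<close>.\<close>

lemma state_space_exists:
  "complex_hilbert_space fun_scale (fun_space (enhanced_states D)) (fun_inner (enhanced_states D))"
  "orthonormal_basis fun_scale (fun_space (enhanced_states D)) (fun_inner (enhanced_states D))
     (enhanced_states D) fun_ket"
  by (simp_all add: fun_space_hilbert fun_ket_basis finite_enhanced_states)

end

theory Submission
  imports Defs
begin

text \<open>
  The amplitude \<open>\<langle>\<psi>|U|\<psi>\<rangle>\<close> is the sum of the diagonal entries of \<open>U\<close>, because \<open>\<psi>\<close> is the sum of an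
  orthonormal eigenbasis. Expanding the bracket at every crossing gives one term
  \<open>(- q) ^ n (q + 1 / q) ^ m\<close> for each choice of smoothings, where \<open>n\<close> is the number of B-smoothings
  and \<open>m\<close> the number of loops (\<open>laurent_eval_bracket\<close>). Multiplying out the loop factors means
  choosing \<open>q\<close> or \<open>1 / q\<close> for each loop, which is to label it with \<open>1\<close> or \<open>- 1\<close>
  (\<open>sum_labellings\<close>); so the
  terms of the full expansion are the eigenvalues of \<open>U\<close>, one for each enhanced state
  (\<open>laurent_eval_bracket_enhanced_states\<close>).

  Unitarity is where \<open>q\<close> has to lie on the unit circle: the eigenvalues then have modulus 1,
  and a linear map that multiplies the vectors of an orthonormal basis by such numbers maps it
  to an orthonormal basis (\<open>unitary_map_on_diagonal\<close>).
\<close>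

section \<open>Evaluation of Laurent polynomials\<close>

text \<open>
  Evaluation at \<open>z \<noteq> 0\<close> is a ring homomorphism. At \<open>0\<close> it is not, as \<open>0 powi k = 0\<close> for
  \<open>k < 0\<close>, although the monomials with exponents \<open>k\<close> and \<open>- k\<close> are inverse to each other.
\<close>

lemma laurent_eval_0 [simp]: "laurent_eval 0 z = 0"
  by (simp add: laurent_eval_def)

lemma laurent_eval_single [simp]: "laurent_eval (Poly_Mapping.single k c) z = of_int c * z powi k"
  by (simp add: laurent_eval_def)

lemma laurent_eval_add [simp]: "laurent_eval (p + r) z = laurent_eval p z + laurent_eval r z"
  unfolding laurent_eval_def
  by (rule setsum_keys_plus_distrib) (simp_all add: algebra_simps)

lemma laurent_eval_diff [simp]: "laurent_eval (p - r) z = laurent_eval p z - laurent_eval r z"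
  using laurent_eval_add [of "p - r" r z] by simp

lemma laurent_eval_single_mult:
  assumes "z \<noteq> 0"
  shows "laurent_eval (Poly_Mapping.single k 1 * p) z = z powi k * laurent_eval p z"
proof (rule frag_induction [of p UNIV])
  fix a b :: laurent
  assume "laurent_eval (Poly_Mapping.single k 1 * a) z = z powi k * laurent_eval a z"
    and "laurent_eval (Poly_Mapping.single k 1 * b) z = z powi k * laurent_eval b z"
  then show "laurent_eval (Poly_Mapping.single k 1 * (a - b)) z = z powi k * laurent_eval (a - b) z"
    by (simp add: right_diff_distrib)
qed (simp_all add: mult_single power_int_add assms)

lemma laurent_eval_mult:
  assumes "z \<noteq> 0"
  shows "laurent_eval (p * r) z = laurent_eval p z * laurent_eval r z"
  by (rule frag_induction [of p UNIV])
    (simp_all add: laurent_eval_single_mult assms left_diff_distrib)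

lemma laurent_eval_power:
  assumes "z \<noteq> 0"
  shows "laurent_eval (p ^ n) z = laurent_eval p z ^ n"
proof (induction n)
  case 0
  have "laurent_eval (Poly_Mapping.single 0 1) z = 1"
    unfolding laurent_eval_single by simp
  then show ?case by simp
next
  case (Suc n)
  then show ?case by (simp add: laurent_eval_mult assms)
qed

section \<open>The state sum\<close>

lemma smoothing_UNIV: "UNIV = {A_smoothing, B_smoothing}"
  using smoothing.exhaust by blast

lemma finite_smoothing_lists: "finite {ts :: smoothing list. length ts = n}"
proof -
  have "finite (UNIV :: smoothing set)"
    by (simp add: smoothing_UNIV)
  from finite_lists_length_eq [OF this, of n] show ?thesis by simp
qed

lemma sum_smoothing_lists_Suc:
  "(\<Sum>ts | length ts = Suc n. f ts) =
     (\<Sum>ts | length ts = n. f (A_smoothing # ts)) + (\<Sum>ts | length ts = n. f (B_smoothing # ts))"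
proof -
  have "{ts. length ts = Suc n} =
      (#) A_smoothing ` {ts. length ts = n} \<union> (#) B_smoothing ` {ts. length ts = n}"
  proof (intro equalityI subsetI)
    fix ts :: "smoothing list"
    assume "ts \<in> {ts. length ts = Suc n}"
    then obtain t us where "ts = t # us" "length us = n"
      by (auto simp: length_Suc_conv)
    then show "ts \<in> (#) A_smoothing ` {ts. length ts = n} \<union> (#) B_smoothing ` {ts. length ts = n}"
      by (cases t) auto
  qed auto
  moreover have "(\<Sum>ts \<in> (#) t ` {ts. length ts = n}. f ts) = (\<Sum>ts | length ts = n. f (t # ts))" for t
    by (simp add: sum.reindex)
  moreover have "(#) A_smoothing ` {ts. length ts = n} \<inter> (#) B_smoothing ` {ts. length ts = n} = {}"
    by auto
  ultimately show ?thesis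
    by (simp add: sum.union_disjoint finite_smoothing_lists)
qed

lemma loops_cong: "set js = set js' \<Longrightarrow> loops js = loops js'"
  by (simp add: loops_def)

text \<open>
  The expansion of the bracket adds the joins of a smoothed crossing to \<open>js\<close>, whereas \<open>resolution\<close>
  keeps the joins in the order of the crossings. The loops depend only on the set of joins, so
  smoothing one crossing after another leads to the same loops as smoothing all of them at once.
\<close>

lemma loops_resolution_Cons:
  "loops (resolution (Diagram (x # xs) js) (t # ts)) =
     loops (resolution (Diagram xs (smooth_crossing t x @ js)) ts)"
  by (rule loops_cong) (auto simp: resolution_def)

lemma laurent_eval_bracket:
  assumes "z \<noteq> 0"
  shows "laurent_eval (bracket (Diagram xs js)) z =
    (\<Sum>ts | length ts = length xs.
       (- z) ^ count_list ts B_smoothing *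
       (z + inverse z) ^ card (loops (resolution (Diagram xs js) ts)))"
proof (induction xs arbitrary: js)
  case Nil
  have "{ts :: smoothing list. length ts = 0} = {[]}" by auto
  then show ?case
    by (simp add: resolution_def laurent_eval_power assms power_int_minus)
next
  case (Cons x xs)
  show ?case
    by (simp add: Cons.IH laurent_eval_single_mult assms sum_smoothing_lists_Suc
        loops_resolution_Cons sum_distrib_left sum_negf mult.assoc)
qed

section \<open>Labelling the loops\<close>

lemma prod_powi_labels:
  fixes z :: "'a :: field"
  assumes "z \<noteq> 0" and "finite L" and l: "l \<in> L \<rightarrow> {1, - 1 :: int}"
  shows "(\<Prod>c\<in>L. z powi l c) = z powi (int (card {c \<in> L. l c = 1}) - int (card {c \<in> L. l c = - 1}))"
proof -
  have "(\<Prod>c\<in>L. z powi l c) = (\<Prod>c\<in>{c \<in> L. l c = 1} \<union> {c \<in> L. l c = - 1}. z powi l c)"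
    using l by (intro prod.cong) auto
  also have "\<dots> = (\<Prod>c | c \<in> L \<and> l c = 1. z powi l c) * (\<Prod>c | c \<in> L \<and> l c = - 1. z powi l c)"
    using assms(2) by (intro prod.union_disjoint) auto
  also have "\<dots> = z ^ card {c \<in> L. l c = 1} * inverse z ^ card {c \<in> L. l c = - 1}"
    by (simp add: power_int_minus)
  also have "\<dots> = z powi (int (card {c \<in> L. l c = 1}) - int (card {c \<in> L. l c = - 1}))"
    using assms(1) by (simp add: power_int_diff power_inverse divide_inverse)
  finally show ?thesis .
qed

text \<open>This is distributivity, with a label recording the summand chosen from a factor.\<close>

lemma sum_labellings:
  fixes z :: "'a :: field"
  assumes "z \<noteq> 0" and "finite L"
  shows "(\<Sum>l \<in> L \<rightarrow>\<^sub>E {1, - 1 :: int}.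
      z powi (int (card {c \<in> L. l c = 1}) - int (card {c \<in> L. l c = - 1}))) = (z + inverse z) ^ card L"
proof -
  have "(z + inverse z) ^ card L = (\<Prod>c\<in>L. \<Sum>e\<in>{1, - 1 :: int}. z powi e)"
    by (simp add: power_int_minus)
  also have "\<dots> = (\<Sum>l \<in> L \<rightarrow>\<^sub>E {1, - 1 :: int}. \<Prod>c\<in>L. z powi l c)"
    using assms(2) by (intro prod_sum_PiE) auto
  also have "\<dots> = (\<Sum>l \<in> L \<rightarrow>\<^sub>E {1, - 1 :: int}.
      z powi (int (card {c \<in> L. l c = 1}) - int (card {c \<in> L. l c = - 1})))"
    using assms by (intro sum.cong prod_powi_labels) (auto simp: PiE_def)
  finally show ?thesis ..
qed

lemma enhanced_states_Sigma:
  "enhanced_states D = Sigma {ts. length ts = length (crossings D)}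
     (\<lambda>ts. loops (resolution D ts) \<rightarrow>\<^sub>E {1, - 1})"
  by (auto simp: enhanced_states_def)

lemma laurent_eval_bracket_enhanced_states:
  assumes "z \<noteq> 0"
  shows "laurent_eval (bracket D) z =
    (\<Sum>s \<in> enhanced_states D. (- 1) ^ n_B s * z powi state_j D s)"
proof -
  have weight: "(- 1) ^ n_B (ts, l) * z powi state_j D (ts, l) =
      (- z) ^ count_list ts B_smoothing * z powi state_lambda D (ts, l)" for ts l
  proof -
    have "n_B (ts, l) = count_list ts B_smoothing"
      by (induction ts) (auto simp: n_B_def)
    moreover have "(- z) ^ n = (- 1) ^ n * z ^ n" for n
      by (rule power_minus)
    ultimately show ?thesis
      using assms by (simp add: state_j_def power_int_add)
  qed
  have "(\<Sum>s \<in> enhanced_states D. (- 1) ^ n_B s * z powi state_j D s) =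
      (\<Sum>ts | length ts = length (crossings D). \<Sum>l \<in> loops (resolution D ts) \<rightarrow>\<^sub>E {1, - 1}.
         (- 1) ^ n_B (ts, l) * z powi state_j D (ts, l))"
    unfolding enhanced_states_Sigma
    by (subst sum.Sigma) (auto simp: finite_smoothing_lists finite_loops intro: finite_PiE)
  also have "\<dots> = (\<Sum>ts | length ts = length (crossings D).
      (- z) ^ count_list ts B_smoothing * (z + inverse z) ^ card (loops (resolution D ts)))"
    by (simp only: weight sum_distrib_left [symmetric] state_lambda_def fst_conv snd_conv
        sum_labellings [OF assms finite_loops])
  also have "\<dots> = laurent_eval (bracket D) z"
    using laurent_eval_bracket [OF assms, of "crossings D" "joins D"] by simp
  finally show ?thesis ..
qed

section \<open>Diagonal maps\<close>

context complex_hilbert_space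
begin

lemma inner_zero_right: "x \<in> V \<Longrightarrow> inner x 0 = 0"
  using inner_scale_right [of x 0 0] subspace_0 [OF subspace_V] by simp

lemma inner_add_left: "x \<in> V \<Longrightarrow> y \<in> V \<Longrightarrow> z \<in> V \<Longrightarrow> inner (x + y) z = inner x z + inner y z"
  using inner_commute [of z "x + y"] inner_commute [of z x] inner_commute [of z y]
  by (simp add: inner_add_right subspace_add [OF subspace_V])

lemma inner_scale_left: "x \<in> V \<Longrightarrow> y \<in> V \<Longrightarrow> inner (scale c x) y = cnj c * inner x y"
  using inner_commute [of y "scale c x"] inner_commute [of y x]
  by (simp add: inner_scale_right subspace_scale [OF subspace_V])

lemma inner_zero_left: "x \<in> V \<Longrightarrow> inner 0 x = 0"
  using inner_scale_left [of 0 x 0] subspace_0 [OF subspace_V] by simp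

lemma inner_sum_right:
  assumes "x \<in> V" and "\<And>i. i \<in> I \<Longrightarrow> f i \<in> V"
  shows "inner x (\<Sum>i\<in>I. f i) = (\<Sum>i\<in>I. inner x (f i))"
  using assms(2)
  by (induction I rule: infinite_finite_induct)
    (simp_all add: assms(1) inner_zero_right inner_add_right subspace_sum [OF subspace_V])

lemma inner_sum_left:
  assumes "x \<in> V" and "\<And>i. i \<in> I \<Longrightarrow> f i \<in> V"
  shows "inner (\<Sum>i\<in>I. f i) x = (\<Sum>i\<in>I. inner (f i) x)"
  using assms(2)
  by (induction I rule: infinite_finite_induct)
    (simp_all add: assms(1) inner_zero_left inner_add_left subspace_sum [OF subspace_V])

lemma linear_map_on_zero:
  assumes "linear_map_on scale V U"
  shows "U 0 = 0"
proof -
  have "U (scale 0 0) = scale 0 (U 0)"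
    using assms subspace_0 [OF subspace_V] unfolding linear_map_on_def by blast
  then show ?thesis by simp
qed

lemma linear_map_on_sum:
  assumes "linear_map_on scale V U" and "\<And>i. i \<in> I \<Longrightarrow> f i \<in> V"
  shows "U (\<Sum>i\<in>I. f i) = (\<Sum>i\<in>I. U (f i))"
  using assms(2)
proof (induction I rule: infinite_finite_induct)
  case (insert i I)
  then have "f i \<in> V" "(\<Sum>i\<in>I. f i) \<in> V"
    by (simp_all add: subspace_sum [OF subspace_V])
  with assms(1) have "U (f i + (\<Sum>i\<in>I. f i)) = U (f i) + U (\<Sum>i\<in>I. f i)"
    unfolding linear_map_on_def by blast
  with insert show ?case by simp
qed (simp_all add: linear_map_on_zero [OF assms(1)])

text \<open>
  For a fixed second argument, both sides are conjugate linear in \<open>x\<close>, and for a fixed first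
  argument they are linear in \<open>y\<close>. So the vectors for which they agree form a subspace, and the
  equation extends from \<open>B\<close> to its span in one argument after the other.
\<close>

lemma linear_map_on_isometric:
  assumes U: "linear_map_on scale V U" and B: "span B = V"
    and iso: "\<And>b b'. b \<in> B \<Longrightarrow> b' \<in> B \<Longrightarrow> inner (U b) (U b') = inner b b'"
    and x: "x \<in> V" and y: "y \<in> V"
  shows "inner (U x) (U y) = inner x y"
proof -
  have mem: "U v \<in> V" and add: "w \<in> V \<Longrightarrow> U (v + w) = U v + U w"
    and scl: "U (scale c v) = scale c (U v)" if "v \<in> V" for v w c
    using U that unfolding linear_map_on_def by blast+
  have BV: "b \<in> V" if "b \<in> B" for b
    using B span_base that by blast
  note V = subspace_0 [OF subspace_V] subspace_add [OF subspace_V] subspace_scale [OF subspace_V]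
  have basis: "inner (U b) (U v) = inner b v" if b: "b \<in> B" and v: "v \<in> V" for b v
  proof -
    have "subspace {v \<in> V. inner (U b) (U v) = inner b v}"
      by (rule subspaceI)
        (simp_all add: V mem add scl BV [OF b] linear_map_on_zero [OF U]
          inner_zero_right inner_add_right inner_scale_right)
    moreover have "B \<subseteq> {v \<in> V. inner (U b) (U v) = inner b v}"
      using b BV iso by auto
    ultimately show ?thesis
      using span_minimal B v by blast
  qed
  have "subspace {v \<in> V. inner (U v) (U y) = inner v y}"
    by (rule subspaceI)
      (simp_all add: V mem add scl y linear_map_on_zero [OF U]
        inner_zero_left inner_add_left inner_scale_left)
  moreover have "B \<subseteq> {v \<in> V. inner (U v) (U y) = inner v y}"
    using y BV basis by auto
  ultimately show ?thesis
    using span_minimal B x by blast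
qed

text \<open>
  As the eigenvalues have modulus 1, \<open>U\<close> preserves the inner products of the basis vectors. They are
  also nonzero, so that the range of \<open>U\<close>, a subspace, contains the basis and hence is everything.
\<close>

lemma unitary_map_on_diagonal:
  assumes basis: "orthonormal_basis scale V inner S ket"
    and U: "linear_map_on scale V U"
    and diag: "\<And>s. s \<in> S \<Longrightarrow> U (ket s) = scale (a s) (ket s)"
    and norm: "\<And>s. s \<in> S \<Longrightarrow> cmod (a s) = 1"
  shows "unitary_map_on scale V inner U"
proof -
  have ket: "ket s \<in> V" if "s \<in> S" for s
    using basis that by (auto simp: orthonormal_basis_def)
  have orth: "inner (ket s) (ket t) = (if s = t then 1 else 0)" if "s \<in> S" "t \<in> S" for s t
    using basis that by (simp add: orthonormal_basis_def)
  have span: "span (ket ` S) = V"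
    using basis by (simp add: orthonormal_basis_def)
  have mem: "U v \<in> V" and add: "w \<in> V \<Longrightarrow> U (v + w) = U v + U w"
    and scl: "U (scale c v) = scale c (U v)" if "v \<in> V" for v w c
    using U that unfolding linear_map_on_def by blast+
  have "inner (U (ket s)) (U (ket t)) = inner (ket s) (ket t)" if "s \<in> S" "t \<in> S" for s t
  proof -
    have "a s * cnj (a s) = 1"
      using norm [OF that(1)] by (simp add: complex_norm_square [symmetric])
    then show ?thesis
      using that by (auto simp: diag inner_scale_left inner_scale_right ket orth
          subspace_scale [OF subspace_V])
  qed
  then have iso: "inner (U x) (U y) = inner x y" if "x \<in> V" "y \<in> V" for x y
    using linear_map_on_isometric [OF U span _ that] by blast
  have "U ` V = V"
  proof
    show "U ` V \<subseteq> V" using mem by blast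
    have "subspace (U ` V)"
    proof (rule subspaceI)
      show "0 \<in> U ` V"
        using linear_map_on_zero [OF U] subspace_0 [OF subspace_V] by force
    next
      fix x y assume "x \<in> U ` V" "y \<in> U ` V"
      then obtain v w where "v \<in> V" "w \<in> V" "x = U v" "y = U w"
        by blast
      then show "x + y \<in> U ` V"
        using subspace_add [OF subspace_V] by (simp add: add [symmetric])
    next
      fix c x assume "x \<in> U ` V"
      then obtain v where "v \<in> V" "x = U v"
        by blast
      then show "scale c x \<in> U ` V"
        using subspace_scale [OF subspace_V] by (simp add: scl [symmetric])
    qed
    moreover have "ket s \<in> U ` V" if s: "s \<in> S" for s
    proof
      have "a s \<noteq> 0" using norm [OF s] by auto
      then show "ket s = U (scale (inverse (a s)) (ket s))"
        by (simp add: scl ket diag s)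
      show "scale (inverse (a s)) (ket s) \<in> V"
        by (simp add: subspace_scale [OF subspace_V] ket s)
    qed
    ultimately show "V \<subseteq> U ` V"
      using span span_minimal by blast
  qed
  with U iso show ?thesis by (simp add: unitary_map_on_def)
qed

lemma amplitude_diagonal:
  assumes basis: "orthonormal_basis scale V inner S ket"
    and U: "linear_map_on scale V U"
    and diag: "\<And>s. s \<in> S \<Longrightarrow> U (ket s) = scale (a s) (ket s)"
  shows "inner (\<Sum>s\<in>S. ket s) (U (\<Sum>s\<in>S. ket s)) = (\<Sum>s\<in>S. a s)"
proof -
  have ket: "ket s \<in> V" if "s \<in> S" for s
    using basis that by (auto simp: orthonormal_basis_def)
  have orth: "inner (ket s) (ket t) = (if s = t then 1 else 0)" if "s \<in> S" "t \<in> S" for s t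
    using basis that by (simp add: orthonormal_basis_def)
  have "U (\<Sum>t\<in>S. ket t) = (\<Sum>t\<in>S. scale (a t) (ket t))"
    using linear_map_on_sum [OF U, of S ket] by (simp add: diag ket)
  then have "inner (\<Sum>s\<in>S. ket s) (U (\<Sum>s\<in>S. ket s)) =
      (\<Sum>t\<in>S. \<Sum>s\<in>S. inner (ket s) (scale (a t) (ket t)))"
    by (simp add: inner_sum_left inner_sum_right ket
        subspace_scale [OF subspace_V] subspace_sum [OF subspace_V])
  also have "\<dots> = (\<Sum>t\<in>S. \<Sum>s\<in>S. if s = t then a t else 0)"
    by (intro sum.cong refl) (simp add: inner_scale_right ket orth)
  also have "\<dots> = (\<Sum>t\<in>S. a t)"
    using basis by (intro sum.cong refl) (simp add: orthonormal_basis_def)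
  finally show ?thesis .
qed

end

section \<open>The bracket as an amplitude\<close>

theorem mainTheorem6:
  fixes D :: diagram and \<theta> :: real and q :: complex
    and scale :: "complex \<Rightarrow> 'h::ab_group_add \<Rightarrow> 'h"
    and H :: "'h set" and inner :: "'h \<Rightarrow> 'h \<Rightarrow> complex"
    and ket :: "enhanced_state \<Rightarrow> 'h" and U :: "'h \<Rightarrow> 'h" and \<psi> :: 'h
  assumes "link_diagram D"
    and "q = exp (\<i> * complex_of_real \<theta>)"
    and "complex_hilbert_space scale H inner"
    and "orthonormal_basis scale H inner (enhanced_states D) ket"
    and "linear_map_on scale H U"
    and "\<And>s. s \<in> enhanced_states D \<Longrightarrow>
           U (ket s) = scale ((- 1) ^ n_B s * q powi state_j D s) (ket s)"
    and "\<psi> = (\<Sum>s \<in> enhanced_states D. ket s)"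
  shows "unitary_map_on scale H inner U \<and> laurent_eval (bracket D) q = inner \<psi> (U \<psi>)"
proof -
  interpret complex_hilbert_space scale H inner by fact
  have "q \<noteq> 0" and "cmod q = 1"
    using assms(2) by (simp_all add: cis_conv_exp [symmetric])
  have "cmod ((- 1) ^ n_B s * q powi state_j D s) = 1" for s
    by (simp add: norm_mult norm_power norm_power_int \<open>cmod q = 1\<close>)
  then have "unitary_map_on scale H inner U"
    by (intro unitary_map_on_diagonal [OF assms(4,5,6)])
  moreover have "laurent_eval (bracket D) q = inner \<psi> (U \<psi>)"
    unfolding assms(7) laurent_eval_bracket_enhanced_states [OF \<open>q \<noteq> 0\<close>]
    by (rule amplitude_diagonal [OF assms(4,5,6), symmetric])
  ultimately show ?thesis ..
qed

end
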